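(* Let $\alpha>\beta$ and $\tau>0$ be constants, and let $G_n\sim \mathrm{SBM}(n,\mu_1,\mu_2,\tau^2)$ with $\mu_1=\alpha\sqrt{\frac{\log n}{n}}$, $\mu_2=\beta\sqrt{\frac{\log n}{n}}$ and planted labeling $\sigma^*\in\Theta_n$. Let $\mathrm{SNR}=\frac{(\alpha-\beta)^2}{8\tau^2}$. If $\mathrm{SNR}<1$, then the maximum likelihood estimator fails to recover $\sigma^*$ with high probability: $$\limsup_{n\to\infty}\mathbb{P}\big(M(\hat\sigma_{MLE},\sigma^* )=1\big)=0,\qquad\text{equivalently}\qquad \liminf_{n\to\infty}\mathbb{P}\big(M(\hat\sigma_{MLE},\sigma^* )\neq 1\big)=1 .$$
   Context: $n$ is even, $[n]=\{1,\dots,n\}$, and $\Theta_n=\{\sigma\in\{\pm1\}^n:\sum_i\sigma_i=0\}$. Gaussian weighted stochastic block model $\mathrm{SBM}(n,\mu_1,\mu_2,\tau^2)$: given a planted (unobserved) labeling $\sigma^*\in\Theta_n$, the observed symmetric weighted adjacency matrix $A=(A_{ij})_{i,j\in[n]}$ has $A_{ii}=0$, and, independently over unordered pairs $\{i,j\}$ with $i\ne j$, $A_{ij}=A_{ji}\sim N(\mu_1,\tau^2)$ if $\sigma^*_i=\sigma^*_j$ and $A_{ij}=A_{ji}\sim N(\mu_2,\tau^2)$ if $\sigma^*_i\neq\sigma^*_j$ ($N(\mu,\tau^2)$ is the normal law with mean $\mu$ and variance $\tau^2$). Agreement ratio: $M(\hat\sigma,\sigma)=\max\left(\frac1n\sum_{i=1}^n\mathbf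 1_{\hat\sigma_i=\sigma_i},\ \frac1n\sum_{i=1}^n\mathbf 1_{-\hat\sigma_i=\sigma_i}\right)$ for $\hat\sigma,\sigma\in\{\pm1\}^n$. The maximum likelihood estimator is $\hat\sigma_{MLE}\in\arg\max_{\sigma\in\Theta_n} f_A(\sigma)$ with $f_A(\sigma)=\sum_{i,j}A_{ij}\sigma_i\sigma_j$ (almost surely unique up to a global sign). *)

theory Defs
  imports "HOL-Probability.Probability"
begin

(* Labelings live on {1..n} and are extensional (undefined outside), so each one is a
   single function and the set of balanced labelings is finite. *)
definition balanced_labelings :: "nat \<Rightarrow> (nat \<Rightarrow> real) set" where
  "balanced_labelings n = {\<sigma> \<in> {1..n} \<rightarrow>\<^sub>E {-1, 1}. (\<Sum>i\<in>{1..n}. \<sigma> i) = 0}"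

(* The parameter v is the variance, whereas normal_density expects the standard deviation.
   The labeling \<sigma> is deterministic. The pairs (i, j) with i < j represent the unordered pairs. *)
locale gaussian_sbm = prob_space M
  for M :: "'w measure" +
  fixes n :: nat and \<mu>\<^sub>1 \<mu>\<^sub>2 v :: real
    and \<sigma> :: "nat \<Rightarrow> real"
    and A :: "nat \<Rightarrow> nat \<Rightarrow> 'w \<Rightarrow> real"
  assumes planted: "\<sigma> \<in> balanced_labelings n"
    and diag: "\<And>i \<omega>. i \<in> {1..n} \<Longrightarrow> \<omega> \<in> space M \<Longrightarrow> A i i \<omega> = 0"
    and sym: "\<And>i j \<omega>. i \<in> {1..n} \<Longrightarrow> j \<in> {1..n} \<Longrightarrow> \<omega> \<in> space M \<Longrightarrow> A i j \<omega> = A j i \<omega>"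
    and indep: "indep_vars (\<lambda>_. borel) (\<lambda>(i, j). A i j) {(i, j). 1 \<le> i \<and> i < j \<and> j \<le> n}"
    and same: "\<And>i j. 1 \<le> i \<Longrightarrow> i < j \<Longrightarrow> j \<le> n \<Longrightarrow> \<sigma> i = \<sigma> j \<Longrightarrow>
      distributed M lborel (A i j) (\<lambda>x. ennreal (normal_density \<mu>\<^sub>1 (sqrt v) x))"
    and diff: "\<And>i j. 1 \<le> i \<Longrightarrow> i < j \<Longrightarrow> j \<le> n \<Longrightarrow> \<sigma> i \<noteq> \<sigma> j \<Longrightarrow>
      distributed M lborel (A i j) (\<lambda>x. ennreal (normal_density \<mu>\<^sub>2 (sqrt v) x))"

definition agreement :: "nat \<Rightarrow> (nat \<Rightarrow> real) \<Rightarrow> (nat \<Rightarrow> real) \<Rightarrow> real" where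
  "agreement n \<sigma>' \<sigma> =
     max ((1 / real n) * (\<Sum>i\<in>{1..n}. of_bool (\<sigma>' i = \<sigma> i)))
         ((1 / real n) * (\<Sum>i\<in>{1..n}. of_bool (- \<sigma>' i = \<sigma> i)))"

definition objective :: "nat \<Rightarrow> (nat \<Rightarrow> nat \<Rightarrow> real) \<Rightarrow> (nat \<Rightarrow> real) \<Rightarrow> real" where
  "objective n a \<sigma> = (\<Sum>i\<in>{1..n}. \<Sum>j\<in>{1..n}. a i j * \<sigma> i * \<sigma> j)"

(* Any measurable selection from the set of maximisers: the maximiser is never unique
   because of the global sign, and no tie-breaking rule is prescribed. *)
definition is_MLE ::
  "'w measure \<Rightarrow> nat \<Rightarrow> (nat \<Rightarrow> nat \<Rightarrow> 'w \<Rightarrow> real) \<Rightarrow> ('w \<Rightarrow> nat \<Rightarrow> real) \<Rightarrow> bool" where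
  "is_MLE M n A \<sigma>hat \<longleftrightarrow>
     \<sigma>hat \<in> measurable M (count_space (balanced_labelings n)) \<and>
     (\<forall>\<omega>\<in>space M. is_arg_max (objective n (\<lambda>i j. A i j \<omega>))
        (\<lambda>\<sigma>. \<sigma> \<in> balanced_labelings n) (\<sigma>hat \<omega>))"

definition SNR :: "real \<Rightarrow> real \<Rightarrow> real \<Rightarrow> real" where
  "SNR \<alpha> \<beta> \<tau> = (\<alpha> - \<beta>)\<^sup>2 / (8 * \<tau>\<^sup>2)"

end

theory Submission
  imports Defs "HOL-Real_Asymp.Real_Asymp"
begin

text \<open>
  Call \<open>d\<^sub>i = \<sigma>\<^sub>i (\<Sum>k. A\<^sub>i\<^sub>k \<sigma>\<^sub>k)\<close> the alignment of vertex \<open>i\<close> with the planted labeling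
  \<open>\<sigma>\<close>. Exchanging a vertex \<open>i\<close> of class \<open>1\<close> with a vertex \<open>j\<close> of class \<open>-1\<close> keeps the
  labeling balanced and lowers the objective by \<open>4 (d\<^sub>i + d\<^sub>j + 2 A\<^sub>i\<^sub>j)\<close>. Hence, if each class
  contains a vertex of alignment below \<open>-t\<close> while all cross weights \<open>A\<^sub>i\<^sub>j\<close> are below \<open>t\<close>, then
  the planted labeling is not a maximiser and no maximum likelihood estimator recovers it.

  Take \<open>t = c \<surd>(n log n)\<close> with a small \<open>c > 0\<close>. The alignment of a vertex is Gaussian with mean
  close to \<open>(\<alpha> - \<beta>)/2 \<surd>(n log n)\<close> and standard deviation close to \<open>\<tau> \<surd>n\<close>, so it is below
  \<open>-t\<close> with probability about \<open>n\<close> to the power \<open>-((\<alpha> - \<beta>)/2 + c)\<^sup>2 / (2 \<tau>\<^sup>2)\<close>. For small \<open>c\<close>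
  this exponent is close to \<open>-SNR\<close>, hence larger than \<open>-1\<close>: among linearly many vertices, one
  with a low alignment is to be expected.

  The alignments of two vertices share an edge, so they are dependent. To decouple them, fix
  \<open>\<lfloor>\<epsilon> n\<rfloor>\<close> vertices \<open>S\<close> in one class. The part of \<open>d\<^sub>i\<close> that comes from edges leaving \<open>S\<close>
  is independent over \<open>i \<in> S\<close> and has almost the full mean and variance; the part inside \<open>S\<close>
  has variance at most \<open>\<epsilon> n \<tau>\<^sup>2\<close>, so for small \<open>\<epsilon>\<close> a union bound keeps it below \<open>t\<close> for all
  vertices of \<open>S\<close> simultaneously. This is \<open>all_well_aligned_prob_le\<close>. Applying it in both
  classes gives \<open>recovery_prob_le\<close>, and \<open>threshold_constants\<close> shows that below the threshold
  the constants can be chosen such that this bound vanishes.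
\<close>

section \<open>Gaussian tails\<close>

text \<open>
  On the tail, the density is at most \<open>exp (- t\<^sup>2 / (2 s\<^sup>2))\<close> times the normal density with mean
  \<open>\<mu> + t\<close>, and that density has total mass one.
\<close>

lemma (in prob_space) normal_upper_tail_le:
  assumes X: "distributed M lborel X (\<lambda>x. ennreal (normal_density \<mu> s x))"
    and s: "s > 0" and t: "t \<ge> 0"
  shows "prob {\<omega> \<in> space M. X \<omega> \<ge> \<mu> + t} \<le> exp (- t\<^sup>2 / (2 * s\<^sup>2))"
proof -
  have [measurable]: "X \<in> borel_measurable M"
    using X by (simp add: distributed_def)
  have shift: "normal_density \<mu> s x \<le> exp (- t\<^sup>2 / (2 * s\<^sup>2)) * normal_density (\<mu> + t) s x"
    if "x \<ge> \<mu> + t" for x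
  proof -
    have "t\<^sup>2 + (x - (\<mu> + t))\<^sup>2 \<le> (x - \<mu>)\<^sup>2"
      using that t mult_nonneg_nonneg[of t "x - \<mu> - t"]
      by (simp add: power2_eq_square algebra_simps)
    then have "- (x - \<mu>)\<^sup>2 / (2 * s\<^sup>2) \<le> - t\<^sup>2 / (2 * s\<^sup>2) + - (x - (\<mu> + t))\<^sup>2 / (2 * s\<^sup>2)"
      using s by (simp add: field_simps)
    then have "exp (- (x - \<mu>)\<^sup>2 / (2 * s\<^sup>2)) \<le> exp (- t\<^sup>2 / (2 * s\<^sup>2)) * exp (- (x - (\<mu> + t))\<^sup>2 / (2 * s\<^sup>2))"
      by (simp flip: exp_add)
    then show ?thesis
      using s by (simp add: normal_density_def divide_right_mono)
  qed
  have "emeasure M {\<omega> \<in> space M. X \<omega> \<ge> \<mu> + t} = emeasure M (X -` {\<mu> + t..} \<inter> space M)"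
    by (intro arg_cong2[where f=emeasure]) auto
  also have "\<dots> = (\<integral>\<^sup>+x. ennreal (normal_density \<mu> s x) * indicator {\<mu> + t..} x \<partial>lborel)"
    by (intro distributed_emeasure[OF X]) auto
  also have "\<dots> \<le> (\<integral>\<^sup>+x. ennreal (exp (- t\<^sup>2 / (2 * s\<^sup>2))) * ennreal (normal_density (\<mu> + t) s x) \<partial>lborel)"
    using shift by (intro nn_integral_mono) (auto simp: indicator_def ennreal_leI simp flip: ennreal_mult)
  also have "\<dots> = ennreal (exp (- t\<^sup>2 / (2 * s\<^sup>2)))"
    using s by (simp add: nn_integral_cmult nn_integral_eq_integral)
  finally show ?thesis
    by (simp add: emeasure_eq_measure)
qed

text \<open>
  The tail contains an interval of length \<open>s\<close>, on which the density is smallest at the end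
  \<open>\<mu> - (z + 1) s\<close>. Being crude by one standard deviation does not change the exponent of \<open>n\<close>
  in the application, where \<open>z\<close> is of order \<open>\<surd>(log n)\<close>.
\<close>

lemma (in prob_space) normal_lower_tail_ge:
  assumes X: "distributed M lborel X (\<lambda>x. ennreal (normal_density \<mu> s x))"
    and s: "s > 0" and z: "z \<ge> 0"
  shows "std_normal_density (z + 1) \<le> prob {\<omega> \<in> space M. X \<omega> \<le> \<mu> - z * s}"
proof -
  have [measurable]: "X \<in> borel_measurable M"
    using X by (simp add: distributed_def)
  define I where "I = {\<mu> - (z + 1) * s .. \<mu> - z * s}"
  have low: "std_normal_density (z + 1) / s \<le> normal_density \<mu> s x" if "x \<in> I" for x
  proof -
    have "0 \<le> z * s"
      using s z by simp
    moreover have "\<mu> - (z * s + s) \<le> x" "x \<le> \<mu> - z * s"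
      using that by (simp_all add: I_def distrib_right)
    ultimately have "\<bar>x - \<mu>\<bar> \<le> \<bar>(z + 1) * s\<bar>"
      using s by (simp add: distrib_right)
    then have "(x - \<mu>)\<^sup>2 \<le> ((z + 1) * s)\<^sup>2"
      by (simp only: abs_le_square_iff)
    then have "(x - \<mu>)\<^sup>2 / (2 * s\<^sup>2) \<le> (z + 1)\<^sup>2 / 2"
      using s by (simp add: power_mult_distrib pos_divide_le_eq)
    then have "exp (- (z + 1)\<^sup>2 / 2) \<le> exp (- (x - \<mu>)\<^sup>2 / (2 * s\<^sup>2))"
      by simp
    then have "1 / (sqrt (2 * pi) * s) * exp (- (z + 1)\<^sup>2 / 2)
        \<le> 1 / (sqrt (2 * pi) * s) * exp (- (x - \<mu>)\<^sup>2 / (2 * s\<^sup>2))"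
      using s by (intro mult_left_mono) auto
    moreover have "sqrt (2 * pi * s\<^sup>2) = sqrt (2 * pi) * s"
      using s by (simp add: real_sqrt_mult)
    ultimately show ?thesis
      by (simp add: normal_density_def)
  qed
  have "ennreal (std_normal_density (z + 1)) = (\<integral>\<^sup>+x. ennreal (std_normal_density (z + 1) / s) * indicator I x \<partial>lborel)"
    using s by (simp add: nn_integral_cmult_indicator I_def algebra_simps flip: ennreal_mult)
  also have "\<dots> \<le> (\<integral>\<^sup>+x. ennreal (normal_density \<mu> s x) * indicator {..\<mu> - z * s} x \<partial>lborel)"
    using low by (intro nn_integral_mono) (auto simp: indicator_def I_def intro!: ennreal_leI)
  also have "\<dots> = emeasure M (X -` {..\<mu> - z * s} \<inter> space M)"
    by (intro distributed_emeasure[OF X, symmetric]) auto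
  also have "\<dots> = emeasure M {\<omega> \<in> space M. X \<omega> \<le> \<mu> - z * s}"
    by (intro arg_cong2[where f=emeasure]) auto
  finally show ?thesis
    by (simp add: emeasure_eq_measure)
qed

section \<open>Exchanging two vertices of opposite classes\<close>

text \<open>
  The objective is a quadratic form. Its linear variation yields the two row sums. Both of these
  count the edge between \<open>i\<close> and \<open>j\<close>, whose contribution does not change because both of its
  endpoints are flipped; the term \<open>2 * a i j\<close> corrects this.
\<close>

lemma objective_exchange:
  assumes ij: "i \<in> {1..n}" "j \<in> {1..n}" "i \<noteq> j" and opp: "\<sigma> i = 1" "\<sigma> j = -1"
    and sym: "\<And>k l. k \<in> {1..n} \<Longrightarrow> l \<in> {1..n} \<Longrightarrow> a k l = a l k"
    and diag: "\<And>k. k \<in> {1..n} \<Longrightarrow> a k k = 0"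
  shows "objective n a (\<sigma>(i := -1, j := 1)) = objective n a \<sigma>
    - 4 * ((\<Sum>k\<in>{1..n}. \<sigma> i * \<sigma> k * a i k) + (\<Sum>k\<in>{1..n}. \<sigma> j * \<sigma> k * a j k) + 2 * a i j)"
proof -
  \<comment> \<open>the increment of the labeling, written as a sum so that finite sums against it evaluate\<close>
  define \<delta> where "\<delta> k = (if k = i then -2 else 0) + (if k = j then 2 else 0 :: real)" for k
  define \<sigma>' where "\<sigma>' = \<sigma>(i := -1, j := 1)"
  have new: "\<sigma>' k = \<sigma> k + \<delta> k" for k
    using ij(3) opp by (auto simp: \<sigma>'_def \<delta>_def)
  have pick: "(\<Sum>k\<in>{1..n}. f k * \<delta> k) = 2 * f j - 2 * f i" for f :: "nat \<Rightarrow> real"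
    using ij by (simp add: \<delta>_def algebra_simps sum.distrib sum.delta if_distrib[of "(*) _"] cong: if_cong)
  have "objective n a \<sigma>' = objective n a \<sigma>
      + (\<Sum>k\<in>{1..n}. \<Sum>l\<in>{1..n}. a k l * \<delta> k * \<sigma> l)
      + (\<Sum>k\<in>{1..n}. \<Sum>l\<in>{1..n}. a k l * \<sigma> k * \<delta> l)
      + (\<Sum>k\<in>{1..n}. \<Sum>l\<in>{1..n}. a k l * \<delta> k * \<delta> l)"
    unfolding objective_def new sum.distrib[symmetric] by (simp add: algebra_simps)
  also have "(\<Sum>k\<in>{1..n}. \<Sum>l\<in>{1..n}. a k l * \<delta> k * \<delta> l)
      = (\<Sum>k\<in>{1..n}. (2 * a k j - 2 * a k i) * \<delta> k)"
  proof (intro sum.cong refl)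
    fix k
    show "(\<Sum>l\<in>{1..n}. a k l * \<delta> k * \<delta> l) = (2 * a k j - 2 * a k i) * \<delta> k"
      using pick[of "\<lambda>l. a k l * \<delta> k"] by (simp only: left_diff_distrib mult.assoc)
  qed
  also have "\<dots> = - 8 * a i j"
    unfolding pick using ij by (simp add: diag sym[of j i])
  also have "(\<Sum>k\<in>{1..n}. \<Sum>l\<in>{1..n}. a k l * \<sigma> k * \<delta> l) = (\<Sum>k\<in>{1..n}. \<Sum>l\<in>{1..n}. a k l * \<delta> k * \<sigma> l)"
    by (subst sum.swap) (auto intro!: sum.cong simp: sym)
  also have "(\<Sum>k\<in>{1..n}. \<Sum>l\<in>{1..n}. a k l * \<delta> k * \<sigma> l)
      = (\<Sum>k\<in>{1..n}. (\<Sum>l\<in>{1..n}. a k l * \<sigma> l) * \<delta> k)"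
    by (simp add: sum_distrib_left mult_ac)
  also have "\<dots> = 2 * (\<Sum>l\<in>{1..n}. a j l * \<sigma> l) - 2 * (\<Sum>l\<in>{1..n}. a i l * \<sigma> l)"
    by (rule pick)
  finally show ?thesis
    unfolding \<sigma>'_def[symmetric] using opp by (simp add: mult_ac sum_negf)
qed

lemma exchange_balanced:
  assumes "\<sigma> \<in> balanced_labelings n" "i \<in> {1..n}" "j \<in> {1..n}" "i \<noteq> j" "\<sigma> i = 1" "\<sigma> j = -1"
  shows "\<sigma>(i := -1, j := 1) \<in> balanced_labelings n"
proof -
  have "(\<Sum>k\<in>{1..n}. (\<sigma>(i := -1, j := 1)) k)
      = (\<Sum>k\<in>{1..n}. \<sigma> k + (if k = i then -2 else 0) + (if k = j then 2 else 0))"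
    using assms by (intro sum.cong) auto
  also have "\<dots> = (\<Sum>k\<in>{1..n}. \<sigma> k)"
    using assms by (simp add: sum.distrib)
  finally show ?thesis
    using assms by (auto simp: balanced_labelings_def PiE_iff extensional_def)
qed

lemma balanced_class_card:
  assumes "\<sigma> \<in> balanced_labelings n" "a \<in> {-1, 1}"
  shows "2 * card {i \<in> {1..n}. \<sigma> i = a} = n"
proof -
  have pm: "\<sigma> i \<in> {-1, 1}" if "i \<in> {1..n}" for i
    using assms that by (auto simp: balanced_labelings_def)
  have "of_bool (\<sigma> i = a) = (1 + a * \<sigma> i) / 2" if "i \<in> {1..n}" for i
    using pm[OF that] assms(2) by auto
  then have "(\<Sum>i\<in>{1..n}. of_bool (\<sigma> i = a)) = (\<Sum>i\<in>{1..n}. (1 + a * \<sigma> i) / 2)"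
    by (intro sum.cong) auto
  also have "\<dots> = (\<Sum>i\<in>{1..n}. 1 / 2) + a / 2 * (\<Sum>i\<in>{1..n}. \<sigma> i)"
    by (simp add: sum.distrib sum_distrib_left add_divide_distrib)
  also have "\<dots> = real n / 2"
    using assms by (simp add: balanced_labelings_def)
  finally have "(\<Sum>i\<in>{1..n}. of_bool (\<sigma> i = a)) = real n / 2" .
  moreover have "(\<Sum>i\<in>{1..n}. of_bool (\<sigma> i = a)) = real (card {i \<in> {1..n}. \<sigma> i = a})"
    by (simp add: Int_def)
  ultimately show ?thesis
    by linarith
qed

lemma agreement_eq_1D:
  assumes "agreement n \<sigma>' \<sigma> = 1" "n > 0"
  shows "(\<forall>i\<in>{1..n}. \<sigma>' i = \<sigma> i) \<or> (\<forall>i\<in>{1..n}. - \<sigma>' i = \<sigma> i)"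
proof -
  have all: "\<forall>i\<in>{1..n}. P i" if "(1 / real n) * (\<Sum>i\<in>{1..n}. of_bool (P i)) = 1" for P
  proof -
    have "card {i \<in> {1..n}. P i} = card {1..n}"
      using that assms(2) by (simp add: Int_def field_simps)
    then have "{i \<in> {1..n}. P i} = {1..n}"
      by (intro card_subset_eq) auto
    then show ?thesis by blast
  qed
  have max_eq_1D: "x = 1 \<or> y = 1" if "max x y = 1" for x y :: real
    using that by (simp add: max_def split: if_splits)
  show ?thesis
    using max_eq_1D[OF assms(1)[unfolded agreement_def]] 
      all[of "\<lambda>i. \<sigma>' i = \<sigma> i"] all[of "\<lambda>i. - \<sigma>' i = \<sigma> i"]
    by blast
qed

lemma objective_eq_of_agreement:
  assumes "agreement n \<sigma>' \<sigma> = 1" "n > 0"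
  shows "objective n a \<sigma>' = objective n a \<sigma>"
  using agreement_eq_1D[OF assms]
proof
  assume "\<forall>i\<in>{1..n}. \<sigma>' i = \<sigma> i"
  then show ?thesis by (simp add: objective_def)
next
  assume *: "\<forall>i\<in>{1..n}. - \<sigma>' i = \<sigma> i"
  have "a i j * \<sigma>' i * \<sigma>' j = a i j * \<sigma> i * \<sigma> j" if "i \<in> {1..n}" "j \<in> {1..n}" for i j
    using *[rule_format, OF that(1), symmetric] *[rule_format, OF that(2), symmetric] by simp
  then show ?thesis
    unfolding objective_def by (intro sum.cong refl)
qed

section \<open>Vertex alignments\<close>

text \<open>
  The independent family of weights is indexed by increasing pairs; \<open>edge\<close> gives the index of
  an unordered pair.
\<close>

definition edge :: "nat \<Rightarrow> nat \<Rightarrow> nat \<times> nat" where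
  "edge i k = (min i k, max i k)"

lemma edge_eq_iff: "edge i k = edge j l \<longleftrightarrow> (i = j \<and> k = l) \<or> (i = l \<and> k = j)"
  by (auto simp: edge_def min_def max_def)

context gaussian_sbm
begin

text \<open>
  The sign turns every edge weight into its contribution to the planted objective, up to the
  factor two that comes from summing over ordered pairs. This makes the distribution of all edge variables a function of the class relation only, so that the two
  classes need not be treated separately.
\<close>

definition signed_weight :: "nat \<times> nat \<Rightarrow> 'w \<Rightarrow> real" where
  "signed_weight e \<omega> = \<sigma> (fst e) * \<sigma> (snd e) * A (fst e) (snd e) \<omega>"

definition alignment :: "nat set \<Rightarrow> nat \<Rightarrow> 'w \<Rightarrow> real" where
  "alignment K i \<omega> = (\<Sum>k\<in>K. signed_weight (edge i k) \<omega>)"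

abbreviation pairs :: "(nat \<times> nat) set" where
  "pairs \<equiv> {(i, j). 1 \<le> i \<and> i < j \<and> j \<le> n}"

lemma label_cases: "i \<in> {1..n} \<Longrightarrow> \<sigma> i = -1 \<or> \<sigma> i = 1"
  using planted by (auto simp: balanced_labelings_def)

lemma edge_in_pairs: "i \<in> {1..n} \<Longrightarrow> k \<in> {1..n} \<Longrightarrow> i \<noteq> k \<Longrightarrow> edge i k \<in> pairs"
  by (auto simp: edge_def)

lemma indep_signed_weight: "indep_vars (\<lambda>_. borel) signed_weight pairs"
proof -
  have "indep_vars (\<lambda>_. borel) (\<lambda>e \<omega>. (\<lambda>x. \<sigma> (fst e) * \<sigma> (snd e) * x) ((\<lambda>(i, j). A i j) e \<omega>)) pairs"
    by (rule indep_vars_compose2[OF indep]) auto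
  then show ?thesis
    by (simp add: signed_weight_def[abs_def] case_prod_beta)
qed

lemma measurable_signed_weight: "e \<in> pairs \<Longrightarrow> signed_weight e \<in> borel_measurable M"
  using indep_signed_weight by (auto simp: indep_vars_def2)

lemma measurable_alignment:
  "i \<in> {1..n} \<Longrightarrow> K \<subseteq> {1..n} - {i} \<Longrightarrow> alignment K i \<in> borel_measurable M"
  unfolding alignment_def[abs_def]
  by (intro borel_measurable_sum measurable_signed_weight edge_in_pairs) auto

lemma signed_weight_edge:
  assumes "i \<in> {1..n}" "k \<in> {1..n}" "\<omega> \<in> space M"
  shows "signed_weight (edge i k) \<omega> = \<sigma> i * \<sigma> k * A i k \<omega>"
  using sym[OF assms] by (auto simp: signed_weight_def edge_def min_def max_def)

lemma signed_weight_normal: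
  assumes v: "v > 0" and ik: "i \<in> {1..n}" "k \<in> {1..n}" "i \<noteq> k"
  shows "distributed M lborel (signed_weight (edge i k))
    (normal_density (if \<sigma> i = \<sigma> k then \<mu>\<^sub>1 else - \<mu>\<^sub>2) (sqrt v))"
proof -
  define a b where "a = min i k" and "b = max i k"
  have ab: "1 \<le> a" "a < b" "b \<le> n" "a \<in> {1..n}" "b \<in> {1..n}" and e: "edge i k = (a, b)"
    and same_iff: "\<sigma> i = \<sigma> k \<longleftrightarrow> \<sigma> a = \<sigma> b"
    using ik by (auto simp: a_def b_def edge_def min_def max_def)
  show ?thesis
  proof (cases "\<sigma> a = \<sigma> b")
    case True
    then have "\<sigma> a * \<sigma> b = 1"
      using label_cases[OF ab(4)] by auto
    then have "signed_weight (edge i k) = A a b"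
      by (simp add: signed_weight_def[abs_def] e fun_eq_iff)
    then show ?thesis
      using True same[OF ab(1-3) True] by (simp add: same_iff)
  next
    case False
    then have "\<sigma> a * \<sigma> b = -1"
      using label_cases[OF ab(4)] label_cases[OF ab(5)] by auto
    then have "signed_weight (edge i k) = (\<lambda>\<omega>. 0 + (-1) * A a b \<omega>)"
      by (simp add: signed_weight_def[abs_def] e fun_eq_iff)
    then show ?thesis
      using False normal_density_affine[OF diff[OF ab(1-3) False], of "-1" 0] v
      by (simp add: same_iff)
  qed
qed

lemma alignment_normal:
  assumes v: "v > 0" and i: "i \<in> {1..n}" and K: "K \<subseteq> {1..n} - {i}" "K \<noteq> {}"
  shows "distributed M lborel (alignment K i)
    (normal_density (real (card {k \<in> K. \<sigma> k = \<sigma> i}) * \<mu>\<^sub>1 - real (card {k \<in> K. \<sigma> k \<noteq> \<sigma> i}) * \<mu>\<^sub>2)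
      (sqrt (real (card K) * v)))"
proof -
  have fin: "finite K"
    using K by (meson finite_Diff finite_atLeastAtMost finite_subset)
  define mean where "mean e = (if \<sigma> (fst e) = \<sigma> (snd e) then \<mu>\<^sub>1 else - \<mu>\<^sub>2)" for e :: "nat \<times> nat"
  have mean_edge: "mean (edge i k) = (if \<sigma> k = \<sigma> i then \<mu>\<^sub>1 else - \<mu>\<^sub>2)" for k
    by (auto simp: mean_def edge_def min_def max_def)
  have inj: "inj_on (edge i) K"
    by (auto simp: inj_on_def edge_eq_iff)
  have "distributed M lborel (\<lambda>\<omega>. \<Sum>e\<in>edge i ` K. signed_weight e \<omega>)
      (normal_density (\<Sum>e\<in>edge i ` K. mean e) (sqrt (\<Sum>e\<in>edge i ` K. (sqrt v)\<^sup>2)))"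
  proof (rule sum_indep_normal)
    show "indep_vars (\<lambda>_. borel) signed_weight (edge i ` K)"
      using i K by (intro indep_vars_subset[OF indep_signed_weight] image_subsetI edge_in_pairs) auto
    fix e assume "e \<in> edge i ` K"
    then obtain k where k: "e = edge i k" "k \<in> K"
      by blast
    then have ik: "k \<in> {1..n}" "i \<noteq> k"
      using K by auto
    show "distributed M lborel (signed_weight e) (normal_density (mean e) (sqrt v))"
      using signed_weight_normal[OF v i ik] by (simp add: k(1) mean_edge eq_commute[of "\<sigma> i"])
  qed (use fin K v in auto)
  moreover have "(\<Sum>e\<in>edge i ` K. mean e)
      = real (card {k \<in> K. \<sigma> k = \<sigma> i}) * \<mu>\<^sub>1 - real (card {k \<in> K. \<sigma> k \<noteq> \<sigma> i}) * \<mu>\<^sub>2"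
    using fin by (simp add: sum.reindex[OF inj] mean_edge sum.If_cases Int_def)
  moreover have "(\<Sum>e\<in>edge i ` K. (sqrt v)\<^sup>2) = real (card K) * v"
    using v by (simp add: card_image[OF inj])
  moreover have "(\<lambda>\<omega>. \<Sum>e\<in>edge i ` K. signed_weight e \<omega>) = alignment K i"
    by (simp add: sum.reindex[OF inj] alignment_def[abs_def])
  ultimately show ?thesis
    by simp
qed

text \<open>
  The stars from distinct vertices of \<open>S\<close> into a set \<open>R\<close> disjoint from \<open>S\<close> have no edge in
  common.
\<close>

lemma indep_alignment:
  assumes S: "S \<subseteq> {1..n}" and R: "R \<subseteq> {1..n}" "S \<inter> R = {}"
  shows "indep_vars (\<lambda>_. borel) (alignment R) S"
proof -
  define rows where "rows i = edge i ` R" for i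
  have "disjoint_family_on rows S"
    using R S by (auto simp: disjoint_family_on_def rows_def edge_eq_iff)
  moreover have "rows i \<subseteq> pairs" if "i \<in> S" for i
    using R S that unfolding rows_def by (intro image_subsetI edge_in_pairs) auto
  ultimately have "indep_vars (\<lambda>i. PiM (rows i) (\<lambda>_. borel))
      (\<lambda>i \<omega>. restrict (\<lambda>e. signed_weight e \<omega>) (rows i)) S"
    by (intro indep_vars_restrict[OF indep_signed_weight])
  then have "indep_vars (\<lambda>_. borel)
      (\<lambda>i \<omega>. (\<lambda>w. \<Sum>k\<in>R. w (edge i k)) (restrict (\<lambda>e. signed_weight e \<omega>) (rows i))) S"
    by (rule indep_vars_compose2)
      (auto simp: rows_def intro!: borel_measurable_sum measurable_component_singleton)
  then show ?thesis
    by (simp add: alignment_def[abs_def] rows_def cong: sum.cong)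
qed

section \<open>Failure of recovery at fixed size\<close>

text \<open>
  The decoupling step. If all alignments are at least \<open>-t\<close>, then either no contribution from
  outside \<open>S\<close> drops to \<open>-2t\<close>, or some contribution from inside \<open>S\<close> reaches \<open>t\<close>. The first
  event is an intersection of independent events, each of probability at most
  \<open>1 - \<phi> \<le> exp (-\<phi>)\<close> for the lower tail bound \<open>\<phi>\<close>; the second one is covered by a union
  bound. The hypothesis \<open>main\<close> says that \<open>-2t\<close> is at most \<open>z\<close> standard deviations below the
  mean of an outer contribution, and \<open>rest\<close> that \<open>t\<close> is at least \<open>u\<close> above the mean of an
  inner one.
\<close>

lemma all_well_aligned_prob_le:
  assumes v: "v > 0" and a: "a \<in> {-1, 1}"
    and S: "S \<subseteq> {i \<in> {1..n}. \<sigma> i = a}" "card S \<ge> 2"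
    and z: "z \<ge> 0" and u: "u \<ge> 0"
    and main: "(n / 2 - card S) * \<mu>\<^sub>1 - n / 2 * \<mu>\<^sub>2 + 2 * t \<le> z * sqrt ((real n - card S) * v)"
    and rest: "(real (card S) - 1) * \<mu>\<^sub>1 + u \<le> t"
  shows "prob {\<omega> \<in> space M. \<forall>i\<in>S. alignment ({1..n} - {i}) i \<omega> \<ge> - t}
    \<le> exp (- (card S * std_normal_density (z + 1))) + card S * exp (- u\<^sup>2 / (2 * (card S * v)))"
proof -
  have finS: "finite S" and Sn: "S \<subseteq> {1..n}"
    using S by (auto intro: finite_subset)
  have S0: "S \<noteq> {}"
    using S(2) by auto
  define R where "R = {1..n} - S"
  define C where "C b = {i \<in> {1..n}. \<sigma> i = b}" for b
  have card_C: "2 * card (C a) = n" "2 * card (C (- a)) = n"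
    using balanced_class_card[OF planted] a by (auto simp: C_def)
  have "card S \<le> card (C a)"
    using S by (intro card_mono) (auto simp: C_def)
  then have n: "2 * card S \<le> n"
    using card_C by linarith
  have lc: "\<sigma> k = -1 \<or> \<sigma> k = 1" if "Suc 0 \<le> k" "k \<le> n" for k
    using label_cases[of k] that by auto
  have R_same: "{k \<in> R. \<sigma> k = a} = C a - S" and R_diff: "{k \<in> R. \<sigma> k \<noteq> a} = C (- a)"
    using S a by (auto simp: R_def C_def dest: lc)
  have card_R_same: "real (card {k \<in> R. \<sigma> k = a}) = n / 2 - card S"
    using card_C n S finS unfolding R_same by (subst card_Diff_subset) (auto simp: C_def of_nat_diff)
  have card_R_diff: "real (card {k \<in> R. \<sigma> k \<noteq> a}) = n / 2"
    using card_C unfolding R_diff by linarith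
  have card_R: "real (card R) = real n - card S"
    using n finS Sn by (simp add: R_def card_Diff_subset of_nat_diff)
  have R0: "R \<noteq> {}"
    using card_R n S(2) by auto
  define sd where "sd = sqrt ((real n - card S) * v)"
  have sd: "sd > 0"
    using n S(2) v by (auto simp: sd_def)

  have [measurable]: "alignment R i \<in> borel_measurable M" "alignment (S - {i}) i \<in> borel_measurable M"
    if "i \<in> S" for i
    using that Sn by (auto simp: R_def intro!: measurable_alignment)

  have outer: "prob {\<omega> \<in> space M. alignment R i \<omega> > - 2 * t} \<le> exp (- std_normal_density (z + 1))"
    if i: "i \<in> S" for i
  proof -
    have ai: "\<sigma> i = a" "i \<in> {1..n}"
      using i S by auto
    have "distributed M lborel (alignment R i)
        (normal_density ((n / 2 - card S) * \<mu>\<^sub>1 - n / 2 * \<mu>\<^sub>2) sd)"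
      using alignment_normal[OF v ai(2), of R] i R0
      by (simp add: R_def[symmetric] ai card_R card_R_same card_R_diff sd_def) (auto simp: R_def)
    from normal_lower_tail_ge[OF this sd z]
    have "std_normal_density (z + 1)
        \<le> prob {\<omega> \<in> space M. alignment R i \<omega> \<le> (n / 2 - card S) * \<mu>\<^sub>1 - n / 2 * \<mu>\<^sub>2 - z * sd}" .
    also have "\<dots> \<le> prob {\<omega> \<in> space M. alignment R i \<omega> \<le> - 2 * t}"
      using i main by (intro finite_measure_mono) (auto simp: sd_def)
    also have "\<dots> = 1 - prob {\<omega> \<in> space M. alignment R i \<omega> > - 2 * t}"
      using i by (subst prob_compl[symmetric]) (auto intro!: arg_cong[where f=prob])
    finally show ?thesis
      using exp_ge_add_one_self[of "- std_normal_density (z + 1)"] by linarith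
  qed
  have inner: "prob {\<omega> \<in> space M. alignment (S - {i}) i \<omega> \<ge> t} \<le> exp (- u\<^sup>2 / (2 * (card S * v)))"
    if i: "i \<in> S" for i
  proof -
    have ai: "\<sigma> i = a" "i \<in> {1..n}"
      using i S by auto
    have card_Si: "real (card (S - {i})) = real (card S) - 1"
      using i finS S(2) by (simp add: card_Diff_singleton of_nat_diff)
    then have "card (S - {i}) > 0"
      using S(2) by linarith
    then have Si0: "S - {i} \<noteq> {}"
      by (metis card.empty less_irrefl)
    have same_part: "{k \<in> S - {i}. \<sigma> k = \<sigma> i} = S - {i}" and diff_part: "{k \<in> S - {i}. \<sigma> k \<noteq> \<sigma> i} = {}"
      using S ai by auto
    have "S - {i} \<subseteq> {1..n} - {i}"
      using Sn by auto
    from alignment_normal[OF v ai(2) this Si0] have "distributed M lborel (alignment (S - {i}) i)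
        (normal_density ((real (card S) - 1) * \<mu>\<^sub>1) (sqrt ((real (card S) - 1) * v)))"
      unfolding same_part diff_part card_Si by simp
    from normal_upper_tail_le[OF this _ u]
    have "prob {\<omega> \<in> space M. alignment (S - {i}) i \<omega> \<ge> (real (card S) - 1) * \<mu>\<^sub>1 + u}
        \<le> exp (- u\<^sup>2 / (2 * ((real (card S) - 1) * v)))"
      using S(2) v by simp
    also have "\<dots> \<le> exp (- u\<^sup>2 / (2 * (card S * v)))"
      using S(2) v by (auto intro!: divide_left_mono mult_pos_pos)
    finally show ?thesis
      using i rest
      by (elim order_trans[rotated]) (intro finite_measure_mono, auto)
  qed

  have "prob {\<omega> \<in> space M. \<forall>i\<in>S. alignment R i \<omega> > - 2 * t}
      = prob (\<Inter>i\<in>S. alignment R i -` {- 2 * t<..} \<inter> space M)"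
    using S0 by (intro arg_cong[where f=prob]) auto
  also have "\<dots> = (\<Prod>i\<in>S. prob (alignment R i -` {- 2 * t<..} \<inter> space M))"
    using Sn S0 finS
    by (intro indep_varsD_finite[OF indep_alignment]) (auto simp: R_def)
  also have "\<dots> = (\<Prod>i\<in>S. prob {\<omega> \<in> space M. alignment R i \<omega> > - 2 * t})"
    by (intro prod.cong refl arg_cong[where f=prob]) auto
  also have "\<dots> \<le> (\<Prod>i\<in>S. exp (- std_normal_density (z + 1)))"
    using outer by (intro prod_mono) auto
  also have "\<dots> = exp (- (card S * std_normal_density (z + 1)))"
    by (simp flip: exp_of_nat_mult)
  finally have outer_all: "prob {\<omega> \<in> space M. \<forall>i\<in>S. alignment R i \<omega> > - 2 * t}
      \<le> exp (- (card S * std_normal_density (z + 1)))" .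
  have "prob (\<Union>i\<in>S. {\<omega> \<in> space M. alignment (S - {i}) i \<omega> \<ge> t})
      \<le> (\<Sum>i\<in>S. prob {\<omega> \<in> space M. alignment (S - {i}) i \<omega> \<ge> t})"
    using finS by (intro finite_measure_subadditive_finite) auto
  also have "\<dots> \<le> card S * exp (- u\<^sup>2 / (2 * (card S * v)))"
    using inner by (intro sum_bounded_above) auto
  finally have inner_all: "prob (\<Union>i\<in>S. {\<omega> \<in> space M. alignment (S - {i}) i \<omega> \<ge> t})
      \<le> card S * exp (- u\<^sup>2 / (2 * (card S * v)))" .

  have split: "alignment ({1..n} - {i}) i \<omega> = alignment R i \<omega> + alignment (S - {i}) i \<omega>"
    if "i \<in> S" for i \<omega>
  proof -
    have "{1..n} - {i} = R \<union> (S - {i})"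
      using that Sn by (auto simp: R_def)
    then show ?thesis
      using finS by (simp add: alignment_def) (subst sum.union_disjoint, auto simp: R_def)
  qed
  have "{\<omega> \<in> space M. \<forall>i\<in>S. alignment ({1..n} - {i}) i \<omega> \<ge> - t}
      \<subseteq> {\<omega> \<in> space M. \<forall>i\<in>S. alignment R i \<omega> > - 2 * t}
        \<union> (\<Union>i\<in>S. {\<omega> \<in> space M. alignment (S - {i}) i \<omega> \<ge> t})"
  proof
    fix \<omega>
    assume \<omega>: "\<omega> \<in> {\<omega> \<in> space M. \<forall>i\<in>S. alignment ({1..n} - {i}) i \<omega> \<ge> - t}"
    have "alignment R i \<omega> > - 2 * t" if "i \<in> S" "alignment (S - {i}) i \<omega> < t" for i
    proof -
      have "- t \<le> alignment R i \<omega> + alignment (S - {i}) i \<omega>"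
        unfolding split[OF that(1), symmetric] using \<omega> that(1) by blast
      then show ?thesis
        using that(2) by linarith
    qed
    then show "\<omega> \<in> {\<omega> \<in> space M. \<forall>i\<in>S. alignment R i \<omega> > - 2 * t}
        \<union> (\<Union>i\<in>S. {\<omega> \<in> space M. alignment (S - {i}) i \<omega> \<ge> t})"
      using \<omega> not_less by blast
  qed
  then have "prob {\<omega> \<in> space M. \<forall>i\<in>S. alignment ({1..n} - {i}) i \<omega> \<ge> - t}
      \<le> prob ({\<omega> \<in> space M. \<forall>i\<in>S. alignment R i \<omega> > - 2 * t}
          \<union> (\<Union>i\<in>S. {\<omega> \<in> space M. alignment (S - {i}) i \<omega> \<ge> t}))"
    using finS by (intro finite_measure_mono) auto
  also have "\<dots> \<le> prob {\<omega> \<in> space M. \<forall>i\<in>S. alignment R i \<omega> > - 2 * t}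
      + prob (\<Union>i\<in>S. {\<omega> \<in> space M. alignment (S - {i}) i \<omega> \<ge> t})"
    using finS by (intro measure_Un_le) auto
  finally show ?thesis
    using outer_all inner_all by linarith
qed

lemma measurable_weight:
  assumes ij: "i \<in> {1..n}" "j \<in> {1..n}"
  shows "A i j \<in> borel_measurable M"
proof -
  have less: "A k l \<in> borel_measurable M" if "k \<in> {1..n}" "l \<in> {1..n}" "k < l" for k l
    using that indep by (auto simp: indep_vars_def2)
  consider "i < j" | "j < i" | "i = j" by linarith
  then show ?thesis
  proof cases
    case 1
    then show ?thesis using less ij by simp
  next
    case 2
    then show ?thesis
      using less[OF ij(2,1)] sym[OF ij] by (simp cong: measurable_cong)
  next
    case 3
    then show ?thesis
      using diag[OF ij(1)] by (simp cong: measurable_cong)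
  qed
qed

lemma cross_weight_prob_le:
  assumes v: "v > 0" and ij: "i \<in> {1..n}" "j \<in> {1..n}" "\<sigma> i \<noteq> \<sigma> j" and w: "w \<ge> 0" "\<mu>\<^sub>2 + w \<le> t"
  shows "prob {\<omega> \<in> space M. A i j \<omega> \<ge> t} \<le> exp (- w\<^sup>2 / (2 * v))"
proof -
  have ordered: "prob {\<omega> \<in> space M. A k l \<omega> \<ge> t} \<le> exp (- w\<^sup>2 / (2 * v))"
    if kl: "k \<in> {1..n}" "l \<in> {1..n}" "k < l" "\<sigma> k \<noteq> \<sigma> l" for k l
  proof -
    have "prob {\<omega> \<in> space M. A k l \<omega> \<ge> t} \<le> prob {\<omega> \<in> space M. A k l \<omega> \<ge> \<mu>\<^sub>2 + w}"
      using measurable_weight[OF kl(1,2)] w by (intro finite_measure_mono) auto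
    also have "\<dots> \<le> exp (- w\<^sup>2 / (2 * (sqrt v)\<^sup>2))"
      using diff[of k l] kl v w by (intro normal_upper_tail_le) auto
    finally show ?thesis
      using v by simp
  qed
  show ?thesis
  proof (cases "i < j")
    case True
    then show ?thesis using ordered ij by simp
  next
    case False
    then have "j < i"
      using ij by (metis linorder_neqE_nat)
    have "{\<omega> \<in> space M. A i j \<omega> \<ge> t} = {\<omega> \<in> space M. A j i \<omega> \<ge> t}"
      using sym[OF ij(1,2)] by auto
    then show ?thesis
      using ordered[OF ij(2,1) \<open>j < i\<close>] ij(3) by simp
  qed
qed

text \<open>
  A successful estimate has the same objective as the planted labeling, since the objective is
  invariant under a global sign. By maximality the exchange of \<open>i\<close> and \<open>j\<close> cannot increase it,
  so a large cross weight has to make up for the two low alignments.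
\<close>

lemma poorly_aligned_pair_obstructs_recovery:
  assumes mle: "is_MLE M n A \<sigma>hat" and n: "n > 0" and \<omega>: "\<omega> \<in> space M"
    and agree: "agreement n (\<sigma>hat \<omega>) \<sigma> = 1"
    and i: "i \<in> {1..n}" "\<sigma> i = 1" "alignment ({1..n} - {i}) i \<omega> < - t"
    and j: "j \<in> {1..n}" "\<sigma> j = -1" "alignment ({1..n} - {j}) j \<omega> < - t"
  shows "A i j \<omega> \<ge> t"
proof -
  define a where "a k l = A k l \<omega>" for k l
  have ij: "i \<noteq> j"
    using i j by auto
  have row: "(\<Sum>l\<in>{1..n}. \<sigma> k * \<sigma> l * a k l) = alignment ({1..n} - {k}) k \<omega>"
    if k: "k \<in> {1..n}" for k
  proof -
    have "(\<Sum>l\<in>{1..n}. \<sigma> k * \<sigma> l * a k l) = (\<Sum>l\<in>{1..n} - {k}. \<sigma> k * \<sigma> l * a k l)"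
      using k diag[OF k \<omega>] by (subst sum.remove[of _ k]) (auto simp: a_def)
    also have "\<dots> = alignment ({1..n} - {k}) k \<omega>"
      unfolding alignment_def using k \<omega> by (intro sum.cong) (auto simp: signed_weight_edge a_def)
    finally show ?thesis .
  qed
  have "objective n a (\<sigma>(i := -1, j := 1)) = objective n a \<sigma> - 4 * ((\<Sum>k\<in>{1..n}. \<sigma> i * \<sigma> k * a i k)
      + (\<Sum>k\<in>{1..n}. \<sigma> j * \<sigma> k * a j k) + 2 * a i j)"
    using i j ij sym diag \<omega> by (intro objective_exchange) (auto simp: a_def)
  also have "objective n a \<sigma> = objective n a (\<sigma>hat \<omega>)"
    by (rule objective_eq_of_agreement[OF agree n, symmetric])
  finally have swap: "objective n a (\<sigma>(i := -1, j := 1)) = objective n a (\<sigma>hat \<omega>)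
      - 4 * (alignment ({1..n} - {i}) i \<omega> + alignment ({1..n} - {j}) j \<omega> + 2 * a i j)"
    unfolding row[OF i(1)] row[OF j(1)] .
  have "\<not> objective n a (\<sigma>hat \<omega>) < objective n a (\<sigma>(i := -1, j := 1))"
    using mle \<omega> exchange_balanced[OF planted i(1) j(1) ij i(2) j(2)]
    by (auto simp: is_MLE_def is_arg_max_def a_def[abs_def])
  then have "0 \<le> alignment ({1..n} - {i}) i \<omega> + alignment ({1..n} - {j}) j \<omega> + 2 * a i j"
    unfolding swap by simp
  then have "a i j \<ge> t"
    using i(3) j(3) by simp
  then show ?thesis
    by (simp add: a_def)
qed

text \<open>
  Recovery forces one of three unlikely events: no low alignment in a sample \<open>S\<close> of the first
  class, none in a sample \<open>T\<close> of the second class, or a cross weight of at least \<open>t\<close>.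
\<close>

lemma recovery_prob_le:
  assumes v: "v > 0" and n: "n > 0" and mle: "is_MLE M n A \<sigma>hat"
    and s: "2 \<le> s" "2 * s \<le> n" and z: "z \<ge> 0" and u: "u \<ge> 0" and w: "w \<ge> 0"
    and main: "(n / 2 - s) * \<mu>\<^sub>1 - n / 2 * \<mu>\<^sub>2 + 2 * t \<le> z * sqrt ((real n - s) * v)"
    and rest: "(real s - 1) * \<mu>\<^sub>1 + u \<le> t"
    and cross: "\<mu>\<^sub>2 + w \<le> t"
  shows "prob {\<omega> \<in> space M. agreement n (\<sigma>hat \<omega>) \<sigma> = 1}
    \<le> 2 * (exp (- (s * std_normal_density (z + 1))) + s * exp (- u\<^sup>2 / (2 * (s * v))))
      + (real n)\<^sup>2 * exp (- w\<^sup>2 / (2 * v))"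
proof -
  define W where "W S = {\<omega> \<in> space M. \<forall>i\<in>S. alignment ({1..n} - {i}) i \<omega> \<ge> - t}" for S
  define Q where "Q = {(i, j). i \<in> {1..n} \<and> j \<in> {1..n} \<and> \<sigma> i = 1 \<and> \<sigma> j = -1}"
  define X where "X = (\<lambda>(i, j). {\<omega> \<in> space M. A i j \<omega> \<ge> t})"
  have subclass_of_card: "\<exists>S. S \<subseteq> {i \<in> {1..n}. \<sigma> i = a} \<and> card S = s" if "a \<in> {-1, 1}" for a
  proof -
    have "s \<le> card {i \<in> {1..n}. \<sigma> i = a}"
      using balanced_class_card[OF planted that] s by linarith
    then show ?thesis
      by (rule obtain_subset_with_card_n) blast
  qed
  obtain S where S: "S \<subseteq> {i \<in> {1..n}. \<sigma> i = 1}" "card S = s"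
    using subclass_of_card[of 1] by auto
  obtain T where T: "T \<subseteq> {i \<in> {1..n}. \<sigma> i = -1}" "card T = s"
    using subclass_of_card[of "-1"] by auto
  have Qn: "Q \<subseteq> {1..n} \<times> {1..n}"
    by (auto simp: Q_def)
  then have finQ: "finite Q"
    by (rule finite_subset) auto
  have W_sets: "W K \<in> events" if "K \<subseteq> {1..n}" for K
  proof -
    have [measurable]: "alignment ({1..n} - {i}) i \<in> borel_measurable M" if "i \<in> K" for i
      using that \<open>K \<subseteq> {1..n}\<close> by (intro measurable_alignment) auto
    have "finite K"
      using \<open>K \<subseteq> {1..n}\<close> by (rule finite_subset) auto
    then show ?thesis
      unfolding W_def by measurable
  qed
  have X_sets: "X q \<in> events" if "q \<in> Q" for q
    using that measurable_weight by (auto simp: X_def Q_def)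
  have WS: "W S \<in> events" and WT: "W T \<in> events"
    using S T by (auto intro!: W_sets)
  have UX: "(\<Union>q\<in>Q. X q) \<in> events"
    using finQ X_sets by auto

  have "prob (\<Union>q\<in>Q. X q) \<le> (\<Sum>q\<in>Q. prob (X q))"
    using finQ X_sets by (intro finite_measure_subadditive_finite) auto
  also have "\<dots> \<le> card Q * exp (- w\<^sup>2 / (2 * v))"
    using cross_weight_prob_le[OF v _ _ _ w cross]
    by (intro sum_bounded_above) (auto simp: X_def Q_def)
  also have "\<dots> \<le> (real n)\<^sup>2 * exp (- w\<^sup>2 / (2 * v))"
    using card_mono[OF _ Qn] by (intro mult_right_mono) (simp_all add: power2_eq_square flip: of_nat_mult)
  finally have PX: "prob (\<Union>q\<in>Q. X q) \<le> (real n)\<^sup>2 * exp (- w\<^sup>2 / (2 * v))" .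

  have "{\<omega> \<in> space M. agreement n (\<sigma>hat \<omega>) \<sigma> = 1} \<subseteq> W S \<union> W T \<union> (\<Union>q\<in>Q. X q)"
  proof
    fix \<omega> assume \<omega>: "\<omega> \<in> {\<omega> \<in> space M. agreement n (\<sigma>hat \<omega>) \<sigma> = 1}"
    show "\<omega> \<in> W S \<union> W T \<union> (\<Union>q\<in>Q. X q)"
    proof (rule ccontr)
      assume no: "\<omega> \<notin> W S \<union> W T \<union> (\<Union>q\<in>Q. X q)"
      obtain i where i: "i \<in> S" "alignment ({1..n} - {i}) i \<omega> < - t"
        using no \<omega> by (auto simp: W_def not_le)
      obtain j where j: "j \<in> T" "alignment ({1..n} - {j}) j \<omega> < - t"
        using no \<omega> by (auto simp: W_def not_le)
      have "i \<in> {1..n}" "\<sigma> i = 1" "j \<in> {1..n}" "\<sigma> j = -1"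
        using i j S T by auto
      then have "A i j \<omega> \<ge> t" "(i, j) \<in> Q"
        using poorly_aligned_pair_obstructs_recovery[OF mle n, of \<omega> i t j] i j \<omega>
        by (auto simp: Q_def)
      then show False
        using no \<omega> by (auto simp: X_def)
    qed
  qed
  then have "prob {\<omega> \<in> space M. agreement n (\<sigma>hat \<omega>) \<sigma> = 1} \<le> prob (W S \<union> W T \<union> (\<Union>q\<in>Q. X q))"
    using WS WT UX by (intro finite_measure_mono) auto
  also have "\<dots> \<le> prob (W S) + prob (W T) + prob (\<Union>q\<in>Q. X q)"
    using WS WT UX measure_Un_le[of "W S \<union> W T" M "\<Union>q\<in>Q. X q"]
      measure_Un_le[of "W S" M "W T"] by auto
  finally show ?thesis
    using PX all_well_aligned_prob_le[OF v _ S(1), of z u t]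
      all_well_aligned_prob_le[OF v _ T(1), of z u t] s z u main rest
    by (simp add: S(2) T(2) W_def of_nat_diff)
qed

end

section \<open>Asymptotics below the threshold\<close>

text \<open>
  The condition \<open>SNR < 1\<close> says that \<open>(\<alpha> - \<beta>) / (2 \<tau>) < \<surd>2\<close>. The constant \<open>\<theta>\<close> lies strictly in
  between: low alignments are sought \<open>\<theta> \<surd>(log n)\<close> standard deviations below the mean, which
  has probability of order larger than \<open>1/n\<close> because \<open>\<theta>\<^sup>2 < 2\<close>. The level \<open>t = c \<surd>(n log n)\<close> uses
  up part of the gap below \<open>\<theta>\<close>. Finally \<open>\<epsilon>\<close>, the proportion of vertices in \<open>S\<close>, is taken so
  small relative to \<open>c\<close> that the edges inside \<open>S\<close> are negligible; since the inequalities that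
  express this are strict at \<open>\<epsilon> = 0\<close>, continuity provides a positive value.
\<close>

lemma threshold_constants:
  fixes \<alpha> \<beta> \<tau> :: real
  assumes "\<alpha> > \<beta>" "\<tau> > 0" "SNR \<alpha> \<beta> \<tau> < 1"
  obtains \<theta> c \<epsilon> where "0 < \<theta>" "\<theta>\<^sup>2 < 2" "0 < c" "0 < \<epsilon>" "\<epsilon> < 1 / 2"
    "(\<alpha> - \<beta>) / 2 + \<epsilon> * \<bar>\<alpha>\<bar> + 2 * c \<le> \<theta> * \<tau> * sqrt (1 - \<epsilon>)"
    "\<epsilon> * \<bar>\<alpha>\<bar> \<le> c" "4 * \<epsilon> * \<tau>\<^sup>2 \<le> (c - \<epsilon> * \<bar>\<alpha>\<bar>)\<^sup>2"
proof -
  define \<theta>\<^sub>0 where "\<theta>\<^sub>0 = (\<alpha> - \<beta>) / (2 * \<tau>)"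
  have \<theta>\<^sub>0: "0 < \<theta>\<^sub>0" "\<theta>\<^sub>0\<^sup>2 < 2"
    using assms by (auto simp: \<theta>\<^sub>0_def SNR_def power_divide power_mult_distrib divide_less_eq)
  then have "\<theta>\<^sub>0 < sqrt 2"
    by (simp add: real_less_rsqrt)
  then obtain \<theta> where \<theta>: "\<theta>\<^sub>0 < \<theta>" "\<theta> < sqrt 2"
    using dense by blast
  have \<theta>2: "\<theta>\<^sup>2 < 2"
    using \<theta> \<theta>\<^sub>0(1) power_strict_mono[of \<theta> "sqrt 2" 2] by simp
  define c where "c = (\<theta> - \<theta>\<^sub>0) * \<tau> / 4"
  have c: "0 < c"
    using \<theta> assms by (simp add: c_def)
  have mid: "(\<alpha> - \<beta>) / 2 + 2 * c < \<theta> * \<tau>"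
  proof -
    have "(\<alpha> - \<beta>) / 2 = \<theta>\<^sub>0 * \<tau>"
      using assms by (simp add: \<theta>\<^sub>0_def)
    moreover have "\<theta>\<^sub>0 * \<tau> < \<theta> * \<tau>"
      using \<theta>(1) assms(2) by simp
    ultimately show ?thesis
      by (simp add: c_def left_diff_distrib field_simps)
  qed
  have "((\<lambda>\<epsilon>. (\<alpha> - \<beta>) / 2 + \<epsilon> * \<bar>\<alpha>\<bar> + 2 * c - \<theta> * \<tau> * sqrt (1 - \<epsilon>))
      \<longlongrightarrow> (\<alpha> - \<beta>) / 2 + 0 * \<bar>\<alpha>\<bar> + 2 * c - \<theta> * \<tau> * sqrt (1 - 0)) (at_right 0)"
    by (intro tendsto_intros)
  then have "\<forall>\<^sub>F \<epsilon> in at_right 0.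
      (\<alpha> - \<beta>) / 2 + \<epsilon> * \<bar>\<alpha>\<bar> + 2 * c - \<theta> * \<tau> * sqrt (1 - \<epsilon>) < 0"
    using mid by (intro order_tendstoD) auto
  moreover have "((\<lambda>\<epsilon>. (c - \<epsilon> * \<bar>\<alpha>\<bar>)\<^sup>2 - 4 * \<epsilon> * \<tau>\<^sup>2) \<longlongrightarrow> (c - 0 * \<bar>\<alpha>\<bar>)\<^sup>2 - 4 * 0 * \<tau>\<^sup>2) (at_right 0)"
    by (intro tendsto_intros)
  from order_tendstoD(1)[OF this, of 0]
  have "\<forall>\<^sub>F \<epsilon> in at_right 0. (c - \<epsilon> * \<bar>\<alpha>\<bar>)\<^sup>2 - 4 * \<epsilon> * \<tau>\<^sup>2 > 0"
    using c by simp
  moreover have "((\<lambda>\<epsilon>. c - \<epsilon> * \<bar>\<alpha>\<bar>) \<longlongrightarrow> c - 0 * \<bar>\<alpha>\<bar>) (at_right 0)"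
    by (intro tendsto_intros)
  then have "\<forall>\<^sub>F \<epsilon> in at_right 0. c - \<epsilon> * \<bar>\<alpha>\<bar> > 0"
    using c by (intro order_tendstoD) auto
  moreover have "\<forall>\<^sub>F \<epsilon> in at_right (0 :: real). 0 < \<epsilon> \<and> \<epsilon> < 1 / 2"
    by (intro eventually_conj eventually_at_right_less) (auto intro!: eventually_at_rightI[of 0 "1/2"])
  ultimately have "\<forall>\<^sub>F \<epsilon> in at_right 0.
      (\<alpha> - \<beta>) / 2 + \<epsilon> * \<bar>\<alpha>\<bar> + 2 * c - \<theta> * \<tau> * sqrt (1 - \<epsilon>) < 0
      \<and> (c - \<epsilon> * \<bar>\<alpha>\<bar>)\<^sup>2 - 4 * \<epsilon> * \<tau>\<^sup>2 > 0 \<and> c - \<epsilon> * \<bar>\<alpha>\<bar> > 0 \<and> 0 < \<epsilon> \<and> \<epsilon> < 1 / 2"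
    by eventually_elim auto
  then obtain \<epsilon> where "(\<alpha> - \<beta>) / 2 + \<epsilon> * \<bar>\<alpha>\<bar> + 2 * c - \<theta> * \<tau> * sqrt (1 - \<epsilon>) < 0"
      "(c - \<epsilon> * \<bar>\<alpha>\<bar>)\<^sup>2 - 4 * \<epsilon> * \<tau>\<^sup>2 > 0" "c - \<epsilon> * \<bar>\<alpha>\<bar> > 0" "0 < \<epsilon>" "\<epsilon> < 1 / 2"
    using eventually_happens'[OF trivial_limit_at_right_real] by blast
  then show ?thesis
    using \<theta> \<theta>\<^sub>0(1) \<theta>2 c by (intro that[of \<theta> c \<epsilon>]) auto
qed

lemma recovery_bound_tendsto_0:
  fixes \<theta> \<epsilon> :: real
  assumes "0 < \<theta>" "\<theta>\<^sup>2 < 2" "0 < \<epsilon>"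
  shows "(\<lambda>n. 2 * (exp (- (\<epsilon> / 2 * real n * std_normal_density (\<theta> * sqrt (ln n) + 1)))
      + real n * exp (- 2 * ln n)) + (real n)\<^sup>2 * exp (- 3 * ln n)) \<longlonglongrightarrow> 0"
proof -
  \<comment> \<open>the exponent left over when \<open>n\<close> competes with the tail probability of order \<open>n\<close> to
     the power \<open>- \<theta>\<^sup>2 / 2\<close>, up to a factor \<open>exp (- \<theta> \<surd>(log n))\<close>\<close>
  define \<kappa> where "\<kappa> = 1 - \<theta>\<^sup>2 / 2"
  have \<kappa>: "\<kappa> > 0"
    using assms by (simp add: \<kappa>_def)
  have "filterlim (\<lambda>n. \<kappa> * ln (real n) - \<theta> * sqrt (ln n) - 1 / 2) at_top at_top"
    using \<kappa> assms(1) by real_asymp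
  then have "filterlim (\<lambda>n. exp (\<kappa> * ln (real n) - \<theta> * sqrt (ln n) - 1 / 2)) at_top at_top"
    by (rule filterlim_compose[OF exp_at_top])
  then have "filterlim (\<lambda>n. \<epsilon> / 2 / sqrt (2 * pi) * exp (\<kappa> * ln (real n) - \<theta> * sqrt (ln n) - 1 / 2)) at_top at_top"
    using assms by (intro filterlim_tendsto_pos_mult_at_top[OF tendsto_const]) auto
  moreover have "\<forall>\<^sub>F n in at_top. \<epsilon> / 2 / sqrt (2 * pi) * exp (\<kappa> * ln (real n) - \<theta> * sqrt (ln n) - 1 / 2)
      = \<epsilon> / 2 * real n * std_normal_density (\<theta> * sqrt (ln n) + 1)"
    using eventually_gt_at_top[of 0]
  proof eventually_elim
    case (elim n)
    have "ln (real n) \<ge> 0"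
      using elim by simp
    then have "\<kappa> * ln (real n) - \<theta> * sqrt (ln n) - 1 / 2 = ln n + (- (\<theta> * sqrt (ln n) + 1)\<^sup>2 / 2)"
      by (simp add: \<kappa>_def power2_sum power_mult_distrib field_simps)
    then have "exp (\<kappa> * ln (real n) - \<theta> * sqrt (ln n) - 1 / 2) = n * exp (- (\<theta> * sqrt (ln n) + 1)\<^sup>2 / 2)"
      using elim by (simp only: exp_add exp_ln of_nat_0_less_iff)
    then show ?case
      by (simp add: std_normal_density_def)
  qed
  ultimately have "filterlim (\<lambda>n. \<epsilon> / 2 * real n * std_normal_density (\<theta> * sqrt (ln n) + 1)) at_top at_top"
    by (rule filterlim_cong[OF refl refl, THEN iffD1, rotated])
  then have "(\<lambda>n. exp (- (\<epsilon> / 2 * real n * std_normal_density (\<theta> * sqrt (ln n) + 1)))) \<longlonglongrightarrow> 0"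
    by (intro filterlim_compose[OF exp_at_bot] filterlim_compose[OF filterlim_uminus_at_bot_at_top])
  moreover have "(\<lambda>n. real n * exp (- 2 * ln n)) \<longlonglongrightarrow> 0"
    by real_asymp
  moreover have "(\<lambda>n. (real n)\<^sup>2 * exp (- 3 * ln n)) \<longlonglongrightarrow> 0"
    by real_asymp
  ultimately have "(\<lambda>n. 2 * (exp (- (\<epsilon> / 2 * real n * std_normal_density (\<theta> * sqrt (ln n) + 1)))
      + real n * exp (- 2 * ln n)) + (real n)\<^sup>2 * exp (- 3 * ln n)) \<longlonglongrightarrow> 2 * (0 + 0) + 0"
    by (intro tendsto_intros)
  then show ?thesis
    by simp
qed

text \<open>
  The bound at fixed size, with \<open>s = \<lfloor>\<epsilon> n\<rfloor>\<close>, \<open>z = \<theta> \<surd>(log n)\<close> and \<open>t = c \<surd>(n log n)\<close>. The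
  exponents \<open>2\<close> and \<open>3\<close> are what beats the union bounds over at most \<open>n\<close> vertices and \<open>n\<^sup>2\<close> pairs;
  the slack conditions on \<open>\<epsilon>\<close> and the largeness conditions on \<open>n\<close> are chosen to reach them.
\<close>

lemma (in gaussian_sbm) recovery_prob_asymptotic_le:
  fixes \<alpha> \<beta> \<tau> \<theta> c \<epsilon> :: real
  assumes \<mu>: "\<mu>\<^sub>1 = \<alpha> * sqrt (ln n / n)" "\<mu>\<^sub>2 = \<beta> * sqrt (ln n / n)" and v: "v = \<tau>\<^sup>2" "\<tau> > 0"
    and mle: "is_MLE M n A \<sigma>hat"
    and \<theta>: "0 < \<theta>" and c: "0 < c" and \<epsilon>: "0 < \<epsilon>" "\<epsilon> < 1 / 2"
    and slack: "(\<alpha> - \<beta>) / 2 + \<epsilon> * \<bar>\<alpha>\<bar> + 2 * c \<le> \<theta> * \<tau> * sqrt (1 - \<epsilon>)"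
      "\<epsilon> * \<bar>\<alpha>\<bar> \<le> c" "4 * \<epsilon> * \<tau>\<^sup>2 \<le> (c - \<epsilon> * \<bar>\<alpha>\<bar>)\<^sup>2"
    and large: "3 \<le> \<epsilon> * n" "\<bar>\<beta>\<bar> \<le> c * n" "6 * \<tau>\<^sup>2 * n \<le> (c * n - \<bar>\<beta>\<bar>)\<^sup>2"
  shows "prob {\<omega> \<in> space M. agreement n (\<sigma>hat \<omega>) \<sigma> = 1}
    \<le> 2 * (exp (- (\<epsilon> / 2 * real n * std_normal_density (\<theta> * sqrt (ln n) + 1)))
        + real n * exp (- 2 * ln n)) + (real n)\<^sup>2 * exp (- 3 * ln n)"
proof -
  \<comment> \<open>\<open>L\<close> is the common scale of the mean weights, and \<open>n * L = \<surd>(n log n)\<close> that of the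
     alignments\<close>
  define s where "s = nat \<lfloor>\<epsilon> * n\<rfloor>"
  define L where "L = sqrt (ln n / n)"
  have n: "n > 0"
    using large(1) by (intro Nat.gr0I) simp
  then have ln0: "ln n \<ge> 0"
    by simp
  have s_le: "real s \<le> \<epsilon> * n" and s_ge: "\<epsilon> * n - 1 \<le> real s"
    using large(1) by (auto simp: s_def)
  have s2: "2 \<le> s"
    using s_ge large(1) by linarith
  have s_half: "\<epsilon> / 2 * n \<le> s"
    using s_ge large(1) by simp
  have "\<epsilon> * n \<le> n / 2"
    using mult_right_mono[of \<epsilon> "1 / 2" n] \<epsilon> by simp
  then have sn: "2 * s \<le> n"
    using s_le by linarith
  have L0: "L \<ge> 0" and L2: "L\<^sup>2 = ln n / n"
    using n ln0 by (auto simp: L_def)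
  have nL: "n * L = sqrt n * sqrt (ln n)"
    using n by (simp add: L_def real_sqrt_divide field_simps)
  have s\<alpha>: "s * \<bar>\<alpha>\<bar> \<le> \<epsilon> * \<bar>\<alpha>\<bar> * n"
    using mult_right_mono[OF s_le, of "\<bar>\<alpha>\<bar>"] by (simp add: mult_ac)

  have "(n / 2 - s) * \<mu>\<^sub>1 - n / 2 * \<mu>\<^sub>2 + 2 * (c * (n * L)) = ((\<alpha> - \<beta>) / 2 * n + (- (s * \<alpha>)) + 2 * c * n) * L"
    by (simp add: \<mu> L_def[symmetric] field_simps)
  also have "\<dots> \<le> ((\<alpha> - \<beta>) / 2 * n + \<epsilon> * \<bar>\<alpha>\<bar> * n + 2 * c * n) * L"
  proof (rule mult_right_mono[OF _ L0])
    have "- (s * \<alpha>) \<le> \<epsilon> * \<bar>\<alpha>\<bar> * n"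
      using s\<alpha> abs_ge_minus_self[of "s * \<alpha>"] by (simp add: abs_mult)
    then show "(\<alpha> - \<beta>) / 2 * n + (- (s * \<alpha>)) + 2 * c * n
        \<le> (\<alpha> - \<beta>) / 2 * n + \<epsilon> * \<bar>\<alpha>\<bar> * n + 2 * c * n"
      by (intro add_mono order_refl)
  qed
  also have "\<dots> = ((\<alpha> - \<beta>) / 2 + \<epsilon> * \<bar>\<alpha>\<bar> + 2 * c) * (n * L)"
    by (simp add: algebra_simps)
  also have "\<dots> \<le> \<theta> * \<tau> * sqrt (1 - \<epsilon>) * (n * L)"
    using slack(1) L0 by (intro mult_right_mono) auto
  also have "\<dots> = \<theta> * sqrt (ln n) * (\<tau> * sqrt ((1 - \<epsilon>) * n))"
    by (simp add: nL real_sqrt_mult)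
  also have "\<dots> \<le> \<theta> * sqrt (ln n) * (\<tau> * sqrt (real n - s))"
    using \<theta> v n ln0 s_le by (intro mult_left_mono) (auto simp: algebra_simps)
  also have "\<dots> = \<theta> * sqrt (ln n) * sqrt ((real n - s) * v)"
    using v by (simp add: real_sqrt_mult)
  finally have main: "(n / 2 - s) * \<mu>\<^sub>1 - n / 2 * \<mu>\<^sub>2 + 2 * (c * (n * L))
      \<le> \<theta> * sqrt (ln n) * sqrt ((real n - s) * v)" .

  define u where "u = (c - \<epsilon> * \<bar>\<alpha>\<bar>) * (n * L)"
  have u0: "u \<ge> 0"
    using slack(2) L0 by (simp add: u_def)
  have "(real s - 1) * \<alpha> \<le> \<epsilon> * \<bar>\<alpha>\<bar> * n"
  proof -
    have "(real s - 1) * \<alpha> \<le> (real s - 1) * \<bar>\<alpha>\<bar>"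
      using s2 by (intro mult_left_mono) auto
    also have "\<dots> \<le> s * \<bar>\<alpha>\<bar>"
      by (intro mult_right_mono) auto
    finally show ?thesis
      using s\<alpha> by linarith
  qed
  then have "(real s - 1) * \<alpha> * L \<le> \<epsilon> * \<bar>\<alpha>\<bar> * n * L"
    using L0 by (rule mult_right_mono)
  then have rest: "(real s - 1) * \<mu>\<^sub>1 + u \<le> c * (n * L)"
    by (simp add: u_def \<mu> L_def[symmetric] algebra_simps)
  have "2 * ln n * (2 * (s * v)) = 4 * s * \<tau>\<^sup>2 * ln n"
    by (simp add: v)
  also have "\<dots> \<le> 4 * (\<epsilon> * n) * \<tau>\<^sup>2 * ln n"
    using s_le ln0 by (intro mult_right_mono mult_left_mono) auto
  also have "\<dots> = 4 * \<epsilon> * \<tau>\<^sup>2 * (n * ln n)"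
    by simp
  also have "\<dots> \<le> (c - \<epsilon> * \<bar>\<alpha>\<bar>)\<^sup>2 * (n * ln n)"
    using slack(3) ln0 by (intro mult_right_mono) auto
  also have "\<dots> = u\<^sup>2"
    using n ln0 by (simp add: u_def nL power_mult_distrib)
  finally have "2 * ln n \<le> u\<^sup>2 / (2 * (s * v))"
    using s2 v by (subst pos_le_divide_eq) auto
  then have "exp (- u\<^sup>2 / (2 * (s * v))) \<le> exp (- 2 * ln n)"
    by simp
  moreover have "real s \<le> n"
    using sn by simp
  ultimately have u_tail: "s * exp (- u\<^sup>2 / (2 * (s * v))) \<le> n * exp (- 2 * ln n)"
    by (intro mult_mono) auto

  define w where "w = (c * n - \<bar>\<beta>\<bar>) * L"
  have w0: "w \<ge> 0"
    using large(2) L0 by (simp add: w_def)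
  have cross: "\<mu>\<^sub>2 + w \<le> c * (n * L)"
    using mult_right_mono[OF abs_ge_self L0, of \<beta>] by (simp add: \<mu> L_def[symmetric] w_def algebra_simps)
  have "3 * ln n * (2 * v) = 6 * \<tau>\<^sup>2 * n * L\<^sup>2"
    using n by (simp add: v L2)
  also have "\<dots> \<le> (c * n - \<bar>\<beta>\<bar>)\<^sup>2 * L\<^sup>2"
    using large(3) by (intro mult_right_mono) auto
  also have "\<dots> = w\<^sup>2"
    by (simp add: w_def power_mult_distrib)
  finally have "3 * ln n \<le> w\<^sup>2 / (2 * v)"
    using v by (subst pos_le_divide_eq) auto
  then have "exp (- w\<^sup>2 / (2 * v)) \<le> exp (- 3 * ln n)"
    by simp
  then have w_tail: "(real n)\<^sup>2 * exp (- w\<^sup>2 / (2 * v)) \<le> (real n)\<^sup>2 * exp (- 3 * ln n)"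
    by (rule mult_left_mono) simp

  have "exp (- (s * std_normal_density (\<theta> * sqrt (ln n) + 1)))
      \<le> exp (- (\<epsilon> / 2 * real n * std_normal_density (\<theta> * sqrt (ln n) + 1)))"
    using mult_right_mono[OF s_half normal_density_nonneg] by simp
  then have "2 * (exp (- (s * std_normal_density (\<theta> * sqrt (ln n) + 1))) + s * exp (- u\<^sup>2 / (2 * (s * v))))
        + (real n)\<^sup>2 * exp (- w\<^sup>2 / (2 * v))
      \<le> 2 * (exp (- (\<epsilon> / 2 * real n * std_normal_density (\<theta> * sqrt (ln n) + 1)))
        + real n * exp (- 2 * ln n)) + (real n)\<^sup>2 * exp (- 3 * ln n)"
    by (intro add_mono[OF _ w_tail] mult_left_mono add_mono[OF _ u_tail]) simp_all
  moreover have "prob {\<omega> \<in> space M. agreement n (\<sigma>hat \<omega>) \<sigma> = 1}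
      \<le> 2 * (exp (- (s * std_normal_density (\<theta> * sqrt (ln n) + 1))) + s * exp (- u\<^sup>2 / (2 * (s * v))))
        + (real n)\<^sup>2 * exp (- w\<^sup>2 / (2 * v))"
    using v \<theta> n ln0 by (intro recovery_prob_le[OF _ _ mle s2 sn _ u0 w0 main rest cross]) auto
  ultimately show ?thesis
    by (rule order_trans[rotated])
qed

theorem theorem1:
  fixes \<alpha> \<beta> \<tau> :: real
    and M :: "nat \<Rightarrow> 'w measure"
    and A :: "nat \<Rightarrow> nat \<Rightarrow> nat \<Rightarrow> 'w \<Rightarrow> real"
    and \<sigma>star :: "nat \<Rightarrow> nat \<Rightarrow> real"
    and \<sigma>hat :: "nat \<Rightarrow> 'w \<Rightarrow> nat \<Rightarrow> real"
  assumes "\<alpha> > \<beta>" and "\<tau> > 0"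
    and sbm: "\<And>n. even n \<Longrightarrow> n > 0 \<Longrightarrow>
      gaussian_sbm (M n) n (\<alpha> * sqrt (ln (real n) / real n)) (\<beta> * sqrt (ln (real n) / real n))
        (\<tau>\<^sup>2) (\<sigma>star n) (A n)"
    and mle: "\<And>n. even n \<Longrightarrow> n > 0 \<Longrightarrow> is_MLE (M n) n (A n) (\<sigma>hat n)"
    and "SNR \<alpha> \<beta> \<tau> < 1"
  shows "limsup (\<lambda>m. ereal (measure (M (2 * m))
           {\<omega> \<in> space (M (2 * m)). agreement (2 * m) (\<sigma>hat (2 * m) \<omega>) (\<sigma>star (2 * m)) = 1})) = 0
       \<and> liminf (\<lambda>m. ereal (measure (M (2 * m))
           {\<omega> \<in> space (M (2 * m)). agreement (2 * m) (\<sigma>hat (2 * m) \<omega>) (\<sigma>star (2 * m)) \<noteq> 1})) = 1"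
proof -
  obtain \<theta> c \<epsilon> where const: "0 < \<theta>" "\<theta>\<^sup>2 < 2" "0 < c" "0 < \<epsilon>" "\<epsilon> < 1 / 2"
    "(\<alpha> - \<beta>) / 2 + \<epsilon> * \<bar>\<alpha>\<bar> + 2 * c \<le> \<theta> * \<tau> * sqrt (1 - \<epsilon>)"
    "\<epsilon> * \<bar>\<alpha>\<bar> \<le> c" "4 * \<epsilon> * \<tau>\<^sup>2 \<le> (c - \<epsilon> * \<bar>\<alpha>\<bar>)\<^sup>2"
    using threshold_constants[OF assms(1,2,5)] .
  define B where "B n = 2 * (exp (- (\<epsilon> / 2 * real n * std_normal_density (\<theta> * sqrt (ln n) + 1)))
      + real n * exp (- 2 * ln n)) + (real n)\<^sup>2 * exp (- 3 * ln n)" for n :: nat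
  define success where "success n = {\<omega> \<in> space (M n). agreement n (\<sigma>hat n \<omega>) (\<sigma>star n) = 1}" for n
  define failure where "failure n = {\<omega> \<in> space (M n). agreement n (\<sigma>hat n \<omega>) (\<sigma>star n) \<noteq> 1}" for n
  have double: "filterlim (\<lambda>m::nat. 2 * m) at_top at_top"
    by (rule mult_nat_left_at_top) simp
  have "B \<longlonglongrightarrow> 0"
    unfolding B_def using recovery_bound_tendsto_0[OF const(1,2,4)] .
  then have B_lim: "(\<lambda>m. B (2 * m)) \<longlonglongrightarrow> 0"
    using double by (rule filterlim_compose)
  have "\<forall>\<^sub>F n in at_top. 3 \<le> \<epsilon> * real n"
    using const by real_asymp
  moreover have "\<forall>\<^sub>F n in at_top. \<bar>\<beta>\<bar> \<le> c * real n"
    using const by real_asymp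
  moreover have "\<forall>\<^sub>F n in at_top. 6 * \<tau>\<^sup>2 * real n \<le> (c * real n - \<bar>\<beta>\<bar>)\<^sup>2"
    using const by real_asymp
  moreover note eventually_gt_at_top[of 0]
  ultimately have "\<forall>\<^sub>F n in at_top. even n \<longrightarrow> measure (M n) (success n) \<le> B n"
  proof eventually_elim
    case (elim n)
    show ?case
    proof
      assume "even n"
      then interpret gaussian_sbm "M n" n "\<alpha> * sqrt (ln n / n)" "\<beta> * sqrt (ln n / n)"
        "\<tau>\<^sup>2" "\<sigma>star n" "A n"
        using elim by (intro sbm)
      show "measure (M n) (success n) \<le> B n"
        unfolding success_def B_def
        using assms(2) const elim mle[OF \<open>even n\<close>]
        by (intro recovery_prob_asymptotic_le[where \<alpha>=\<alpha> and \<beta>=\<beta> and \<tau>=\<tau> and c=c]) auto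
    qed
  qed
  from eventually_compose_filterlim[OF this double]
  have "\<forall>\<^sub>F m in at_top. measure (M (2 * m)) (success (2 * m)) \<le> B (2 * m)"
    by simp
  then have success_lim: "(\<lambda>m. measure (M (2 * m)) (success (2 * m))) \<longlonglongrightarrow> 0"
    by (intro tendsto_sandwich[OF _ _ tendsto_const B_lim]) auto
  have complement: "measure (M n) (failure n) = 1 - measure (M n) (success n)" if "even n" "n > 0" for n
  proof -
    interpret gaussian_sbm "M n" n "\<alpha> * sqrt (ln n / n)" "\<beta> * sqrt (ln n / n)" "\<tau>\<^sup>2" "\<sigma>star n" "A n"
      using that by (rule sbm)
    have [measurable]: "\<sigma>hat n \<in> measurable (M n) (count_space (balanced_labelings n))"
      using mle[OF that] by (simp add: is_MLE_def)
    have "(\<lambda>\<omega>. agreement n (\<sigma>hat n \<omega>) (\<sigma>star n)) \<in> borel_measurable (M n)"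
      by (rule measurable_compose[where f="\<sigma>hat n" and N="count_space (balanced_labelings n)"]) simp_all
    then have "success n \<in> events"
      unfolding success_def by measurable
    moreover have "failure n = space (M n) - success n"
      by (auto simp: success_def failure_def)
    ultimately show ?thesis
      by (simp add: prob_compl)
  qed
  have "\<forall>\<^sub>F m in at_top. 1 - measure (M (2 * m)) (success (2 * m)) = measure (M (2 * m)) (failure (2 * m))"
    using eventually_gt_at_top[of 0] by eventually_elim (simp add: complement)
  moreover have "(\<lambda>m. 1 - measure (M (2 * m)) (success (2 * m))) \<longlonglongrightarrow> 1"
    using tendsto_diff[OF tendsto_const success_lim, of 1] by simp
  ultimately have failure_lim: "(\<lambda>m. measure (M (2 * m)) (failure (2 * m))) \<longlonglongrightarrow> 1"
    by (rule Lim_transform_eventually[rotated])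
  have "limsup (\<lambda>m. ereal (measure (M (2 * m)) (success (2 * m)))) = ereal 0"
    using success_lim by (intro lim_imp_Limsup) (auto simp: tendsto_ereal)
  moreover have "liminf (\<lambda>m. ereal (measure (M (2 * m)) (failure (2 * m)))) = ereal 1"
    using failure_lim by (intro lim_imp_Liminf) (auto simp: tendsto_ereal)
  ultimately show ?thesis
    by (simp add: success_def failure_def zero_ereal_def one_ereal_def)
qed

end
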